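(* Let $n$ be a positive integer and let $\alpha,\beta\in S_n$. If the commutator $[\alpha,\beta]=\alpha^{-1}\beta^{-1}\alpha\beta$ has at least $n-4$ fixed points in $\{1,\dots,n\}$, then there exists a permutation $\gamma\in S_n$ such that $\alpha^\gamma=\alpha^{-1}$ and $\beta^\gamma=\beta^{-1}$.
   Context: $S_n$ is the symmetric group on $[n]=\{1,2,\dots,n\}$. For $\alpha,\gamma\in S_n$, $\alpha^\gamma=\gamma^{-1}\alpha\gamma$. *)

theory Defs
  imports "HOL-Combinatorics.Permutations"
begin

text \<open>
  Elements of the symmetric group on \<open>{1..n}\<close> are the functions \<open>p\<close> with \<open>p permutes {1..n}\<close>, and
  the group product \<open>a b\<close> is read as \<open>a \<circ> b\<close>. Reading it in the opposite order turns the
  commutator into a conjugate of its inverse, which has the same number of fixed points, and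
  conjugation by \<open>g\<close> into conjugation by \<open>inv g\<close>.
\<close>

definition perm_conj :: "('a \<Rightarrow> 'a) \<Rightarrow> ('a \<Rightarrow> 'a) \<Rightarrow> 'a \<Rightarrow> 'a" where
  "perm_conj \<alpha> \<gamma> = inv \<gamma> \<circ> \<alpha> \<circ> \<gamma>"

definition perm_commutator :: "('a \<Rightarrow> 'a) \<Rightarrow> ('a \<Rightarrow> 'a) \<Rightarrow> 'a \<Rightarrow> 'a" where
  "perm_commutator \<alpha> \<beta> = inv \<alpha> \<circ> inv \<beta> \<circ> \<alpha> \<circ> \<beta>"

end

theory Submission
  imports Defs "HOL-Combinatorics.Orbits" "HOL-Combinatorics.Cycles"
begin

text \<open>
  Glue unit squares, one for each point, so that \<open>f = inv \<alpha>\<close> leads from each square to its right neighbour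
  and \<open>t = inv \<beta>\<close> to its upper neighbour. The nontrivial cycles of the commutator
  \<open>d = t \<circ> f \<circ> inv t \<circ> inv f\<close> are the cone points of the resulting surface. As \<open>d\<close> is even and moves at
  most four points, it is the identity, a 3-cycle or a double transposition, so every component of the
  surface is a torus or has genus two. Such a surface has a symmetry that turns every square by
  180 degrees (for genus two it is the hyperelliptic involution), and this symmetry inverts both
  permutations. The proof constructs the symmetry combinatorially from the decomposition of the surface
  into horizontal cylinders.

  Since \<open>t \<circ> f = d \<circ> f \<circ> t\<close>, the map \<open>t\<close> carries the cycles of \<open>f\<close> (the rows) to the cycles of \<open>d \<circ> f\<close>.
  A row that avoids the support \<open>M\<close> of \<open>d\<close> is a cycle of both and lies squarely on the row below it.
  So the rows that meet \<open>M\<close> are the bottom rows of maximal cylinders, and the surface is determined by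
  the bottom rows, the heights of the cylinders and the first return map \<open>T\<close> of \<open>t\<close> to the bottom rows.
  Components without such rows are tori, on which \<open>f\<close> and \<open>t\<close> commute
  (\<open>commuting_permutations_inverted\<close>).

  It remains to rotate each cylinder onto itself, compatibly with the gluing \<open>T\<close>. The points of \<open>M\<close> cut
  the bottom rows into at most four segments. The cycles of \<open>f\<close> and of \<open>d \<circ> f\<close> run through these same
  segments in different orders, given by permutations \<open>b\<close> and \<open>d \<circ> b\<close> of \<open>M\<close>. What is needed is an
  involution \<open>\<pi>\<close> of the segments that preserves lengths, satisfies \<open>\<pi> \<circ> inv b \<circ> \<pi> = d \<circ> b\<close> and maps the
  segments of each row to those of the row that \<open>T\<close> assigns to it. Writing \<open>\<pi> = r \<circ> b\<close> turns the middle
  condition into \<open>r \<circ> r = d\<close>, so there are at most two candidates for \<open>\<pi>\<close>; that one of them works is a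
  finite check in which the only input is that rows matched by \<open>T\<close> have the same length
  (\<open>exists_square_root\<close>). Reversing the segments according to \<open>\<pi>\<close> and applying \<open>inv T\<close> reflects every
  bottom row in itself (\<open>orbit_preserving_reflection\<close>), and turning the cylinders upside down extends it
  to the whole surface. Both extension steps are instances of the flip of towers over a base.
\<close>

section \<open>Towers over a base\<close>

text \<open>
  Let \<open>f\<close> be a permutation with finite orbits and \<open>M\<close> a set of base points. Every point of an orbit that
  meets \<open>M\<close> lies in exactly one tower \<open>u, f u, f (f u), \<dots>\<close> over a base point \<open>u\<close>; the tower ends just
  before the orbit comes back to \<open>M\<close>, so its height is the return time of \<open>u\<close>.
\<close>

definition return_time :: "('a \<Rightarrow> 'a) \<Rightarrow> 'a set \<Rightarrow> 'a \<Rightarrow> nat" where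
  "return_time f M x = (LEAST k. 0 < k \<and> (f ^^ k) x \<in> M)"

definition first_return :: "('a \<Rightarrow> 'a) \<Rightarrow> 'a set \<Rightarrow> 'a \<Rightarrow> 'a" where
  "first_return f M x = (if x \<in> M then (f ^^ return_time f M x) x else x)"

definition saturation :: "('a \<Rightarrow> 'a) \<Rightarrow> 'a set \<Rightarrow> 'a set" where
  "saturation f M = (\<Union>u\<in>M. orbit f u)"

definition level :: "('a \<Rightarrow> 'a) \<Rightarrow> 'a set \<Rightarrow> 'a \<Rightarrow> nat" where
  "level f M x = (LEAST i. (inv f ^^ i) x \<in> M)"

text \<open>
  A map \<open>g\<close> of the base lifts to the map that carries the tower over \<open>u\<close> onto the tower over \<open>g u\<close>
  upside down. If the towers are segments of rows, this reverses the segments; if they are the columns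
  of cylinders, it turns the cylinders upside down.
\<close>

definition tower_flip :: "('a \<Rightarrow> 'a) \<Rightarrow> 'a set \<Rightarrow> ('a \<Rightarrow> 'a) \<Rightarrow> 'a \<Rightarrow> 'a" where
  "tower_flip f M g x =
     (if x \<in> saturation f M
      then let i = level f M x; u = (inv f ^^ i) x in (f ^^ (return_time f M u - Suc i)) (g u)
      else x)"

lemma funpow_pred: "0 < k \<Longrightarrow> f ((f ^^ (k - Suc 0)) x) = (f ^^ k) x"
  by (cases k) auto

lemma return_time_eqI:
  assumes "0 < k" "(f ^^ k) x \<in> M" "\<And>j. 0 < j \<Longrightarrow> j < k \<Longrightarrow> (f ^^ j) x \<notin> M"
  shows "return_time f M x = k"
  unfolding return_time_def using assms by (intro Least_equality) (auto simp: not_less[symmetric])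

lemma funpow_not_in_base: "0 < k \<Longrightarrow> k < return_time f M x \<Longrightarrow> (f ^^ k) x \<notin> M"
  unfolding return_time_def using not_less_Least by blast

lemma inv_funpow_cancel:
  fixes f :: "'a \<Rightarrow> 'a"
  assumes "bij f" shows "(inv f ^^ i) ((f ^^ i) x) = x"
  using inv_f_f[OF bij_is_inj[OF bij_fn[OF assms]], of i x] by (simp add: inv_fn[OF assms])

context
  fixes f :: "'a \<Rightarrow> 'a"
  assumes f: "permutation f"
begin

lemma return_time_works:
  assumes "x \<in> M"
  shows "0 < return_time f M x" "(f ^^ return_time f M x) x \<in> M"
proof -
  obtain k where "0 < k" "(f ^^ k) x = x"
    using permutation_self[OF f] by metis
  with assms have "\<exists>k. 0 < k \<and> (f ^^ k) x \<in> M" by auto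
  from LeastI_ex[OF this]
  show "0 < return_time f M x" "(f ^^ return_time f M x) x \<in> M"
    unfolding return_time_def by auto
qed

lemma first_return_in: "x \<in> M \<Longrightarrow> first_return f M x \<in> M"
  by (simp add: first_return_def return_time_works)

lemma level_funpow:
  assumes u: "u \<in> M" and i: "i < return_time f M u"
  shows "level f M ((f ^^ i) u) = i"
proof -
  have eq: "(inv f ^^ j) ((f ^^ i) u) = (f ^^ (i - j)) u" if "j \<le> i" for j
  proof -
    have "(f ^^ i) u = (f ^^ j) ((f ^^ (i - j)) u)"
      using that by (metis funpow_add le_add_diff_inverse o_apply)
    then show ?thesis using inv_funpow_cancel[OF permutation_bijective[OF f]] by simp
  qed
  show ?thesis unfolding level_def
  proof (rule Least_equality)
    show "(inv f ^^ i) ((f ^^ i) u) \<in> M" using eq[of i] u by simp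
    show "i \<le> j" if "(inv f ^^ j) ((f ^^ i) u) \<in> M" for j
      using that eq[of j] funpow_not_in_base[of "i - j" f M u] i by (cases "i \<le> j") auto
  qed
qed

lemma funpow_in_saturation:
  assumes "u \<in> M" shows "(f ^^ i) u \<in> saturation f M"
proof -
  have "(f ^^ i) u \<in> orbit f u"
    by (rule funpow_in_orbit) (rule permutation_self_in_orbit[OF f])
  with assms show ?thesis by (auto simp: saturation_def)
qed

lemma base_subset_saturation: "M \<subseteq> saturation f M"
  unfolding saturation_def using permutation_self_in_orbit[OF f] by blast

lemma saturation_step_iff: "f x \<in> saturation f M \<longleftrightarrow> x \<in> saturation f M"
proof -
  have "f x \<in> orbit f u \<longleftrightarrow> x \<in> orbit f u" for u
  proof
    assume "f x \<in> orbit f u"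
    moreover have "x \<in> orbit f (f x)"
      using permutation_orbit_step[OF f] permutation_self_in_orbit[OF f] by simp
    ultimately show "x \<in> orbit f u" by (rule orbit_trans[rotated])
  qed (rule orbit.step)
  then show ?thesis by (simp add: saturation_def)
qed

text \<open>
  Applying \<open>f\<close> moves up one level, and from the top level it leads to the bottom of the tower over
  the first return of its base point. Hence the towers over a set of base points that is closed under
  first return contain the whole orbits of these base points.
\<close>

lemma orbit_tower_cases:
  assumes S: "S \<subseteq> M" "\<And>u. u \<in> S \<Longrightarrow> first_return f M u \<in> S" and x: "x \<in> orbit f u" "u \<in> S"
  obtains v i where "v \<in> S" "i < return_time f M v" "x = (f ^^ i) v"
proof -
  have succ: "\<exists>w\<in>S. \<exists>j<return_time f M w. f ((f ^^ i) v) = (f ^^ j) w"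
    if v: "v \<in> S" "i < return_time f M v" for v i
  proof (cases "Suc i < return_time f M v")
    case True
    then show ?thesis using v by (intro bexI[of _ v] exI[of _ "Suc i"]) auto
  next
    case False
    with v have i: "return_time f M v = Suc i" by simp
    then have "f ((f ^^ i) v) = first_return f M v"
      using v S by (auto simp: first_return_def)
    then show ?thesis
      using S v return_time_works(1)[of "first_return f M v" M]
      by (intro bexI[of _ "first_return f M v"] exI[of _ 0]) auto
  qed
  from x(1) have "\<exists>w\<in>S. \<exists>j<return_time f M w. x = (f ^^ j) w"
  proof induction
    case base
    show ?case using succ[of u 0] return_time_works(1)[of u M] x(2) S(1) by auto
  next
    case (step y)
    then show ?case using succ by blast
  qed
  then show ?thesis using that by blast
qed

lemma saturation_cases:
  assumes "x \<in> saturation f M"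
  obtains u i where "u \<in> M" "i < return_time f M u" "x = (f ^^ i) u"
proof -
  obtain v where v: "v \<in> M" "x \<in> orbit f v"
    using assms by (auto simp: saturation_def)
  show ?thesis
    by (rule orbit_tower_cases[OF subset_refl first_return_in v(2,1)]) (use that in auto)
qed

lemma funpow_tower_unique:
  assumes "u \<in> M" "i < return_time f M u" "v \<in> M" "j < return_time f M v" "(f ^^ i) u = (f ^^ j) v"
  shows "i = j" "u = v"
proof -
  show "i = j" using assms level_funpow by metis
  with assms show "u = v"
    by (metis bij_fn bij_is_inj f injD permutation_bijective)
qed

lemma first_return_permutes:
  assumes "finite M" shows "first_return f M permutes M"
proof (rule bij_imp_permutes)
  have "inj_on (first_return f M) M"
  proof (rule inj_onI)
    fix u v assume uv: "u \<in> M" "v \<in> M" "first_return f M u = first_return f M v"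
    let ?i = "return_time f M u - 1" and ?j = "return_time f M v - 1"
    have "f ((f ^^ ?i) u) = f ((f ^^ ?j) v)"
      using uv return_time_works(1)
      by (simp add: first_return_def funpow_pred)
    then have "(f ^^ ?i) u = (f ^^ ?j) v"
      using permutation_bijective[OF f] by (simp add: bij_is_inj inj_eq)
    then show "u = v" using funpow_tower_unique(2)[of u M ?i v ?j] uv return_time_works(1) by simp
  qed
  then show "bij_betw (first_return f M) M M"
    using assms first_return_in by (simp add: bij_betw_def endo_inj_surj image_subset_iff)
qed (simp add: first_return_def)

text \<open>
  The heights of the towers are the weights with which the base points of an orbit count its size.
\<close>

lemma card_eq_sum_return_time:
  assumes K: "K \<subseteq> saturation f M" "\<And>x. f x \<in> K \<longleftrightarrow> x \<in> K" and M: "finite M"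
  shows "card K = (\<Sum>u\<in>M \<inter> K. return_time f M u)"
proof -
  let ?T = "\<lambda>u. (\<lambda>i. (f ^^ i) u) ` {..<return_time f M u}"
  have K': "(f ^^ i) u \<in> K \<longleftrightarrow> u \<in> K" for u i by (induction i) (auto simp: K(2))
  have "K = (\<Union>u\<in>M \<inter> K. ?T u)"
    using K(1) K' by (fastforce elim: saturation_cases)
  also have "card \<dots> = (\<Sum>u\<in>M \<inter> K. card (?T u))"
    using M funpow_tower_unique(2) by (intro card_UN_disjoint) fastforce+
  also have "\<dots> = (\<Sum>u\<in>M \<inter> K. return_time f M u)"
  proof (rule sum.cong)
    fix u assume "u \<in> M \<inter> K"
    then have "inj_on (\<lambda>i. (f ^^ i) u) {..<return_time f M u}"
      using funpow_tower_unique(1)[of u M _ u] by (intro inj_onI) simp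
    then show "card (?T u) = return_time f M u" by (simp add: card_image)
  qed simp
  finally show ?thesis .
qed

lemma base_separation:
  assumes "S \<subseteq> M" "\<And>u. u \<in> S \<Longrightarrow> first_return f M u \<in> S" "u \<in> S" "v \<in> M" "v \<in> orbit f u"
  shows "v \<in> S"
proof -
  obtain w i where w: "w \<in> S" "i < return_time f M w" "v = (f ^^ i) w"
    using orbit_tower_cases[OF assms(1,2,5,3)] .
  then have "v = w"
    using funpow_tower_unique(2)[of v M 0 w i] assms(1,4) return_time_works(1)[of v M] by auto
  with w show ?thesis by simp
qed

lemma tower_flip_funpow:
  assumes "u \<in> M" "i < return_time f M u"
  shows "tower_flip f M g ((f ^^ i) u) = (f ^^ (return_time f M u - Suc i)) (g u)"
  by (simp add: tower_flip_def Let_def funpow_in_saturation level_funpow assms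
      inv_funpow_cancel[OF permutation_bijective[OF f]])

context
  fixes M :: "'a set" and g :: "'a \<Rightarrow> 'a"
  assumes g: "\<And>u. u \<in> M \<Longrightarrow> g u \<in> M" "\<And>u. u \<in> M \<Longrightarrow> g (g u) = u"
    "\<And>u. u \<in> M \<Longrightarrow> return_time f M (g u) = return_time f M u"
begin

lemma tower_flip_involution: "tower_flip f M g (tower_flip f M g x) = x"
proof (cases "x \<in> saturation f M")
  case True
  then obtain u i where u: "u \<in> M" "i < return_time f M u" "x = (f ^^ i) u"
    by (rule saturation_cases)
  then show ?thesis using g by (simp add: tower_flip_funpow)
qed (simp add: tower_flip_def)

lemma tower_flip_in_saturation: "x \<in> saturation f M \<Longrightarrow> tower_flip f M g x \<in> saturation f M"
  by (metis g(1) saturation_cases tower_flip_funpow funpow_in_saturation)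

text \<open>
  Flipped towers reverse \<open>f\<close>: one step up before the flip is one step down after it, so \<open>f\<close> after the
  flip undoes \<open>f\<close> before the flip as long as both points stay in one tower. At the seams between towers
  the same relation for the first return map has to be assumed. The twist \<open>d\<close> is only felt at base
  points, so one lemma serves two purposes: with \<open>d = id\<close> the flip inverts \<open>f\<close>, and for general \<open>d\<close> it
  conjugates \<open>inv f\<close> to \<open>d \<circ> f\<close>.
\<close>

lemma tower_flip_step:
  assumes d: "\<And>x. x \<notin> M \<Longrightarrow> d x = x"
    and base: "\<And>u. u \<in> M \<Longrightarrow> d (first_return f M (g (first_return f M u))) = g u"
    and x: "x \<in> saturation f M"
  shows "d (f (tower_flip f M g (f x))) = tower_flip f M g x"
proof -
  obtain u i where u: "u \<in> M" "i < return_time f M u" and xu: "x = (f ^^ i) u"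
    using x by (rule saturation_cases)
  show ?thesis
  proof (cases "Suc i < return_time f M u")
    case True
    let ?k = "return_time f M u - Suc i"
    \<comment> \<open>Both \<open>x\<close> and \<open>f x\<close> lie in the tower over \<open>u\<close>, so no base point is met.\<close>
    have "f (tower_flip f M g (f x)) = (f ^^ ?k) (g u)"
      using tower_flip_funpow[OF u(1) True, of g] True funpow_pred[of ?k f "g u"]
      by (simp add: xu funpow_pred)
    moreover have "(f ^^ ?k) (g u) \<notin> M"
      using True g u by (intro funpow_not_in_base) auto
    ultimately show ?thesis using d u by (simp add: xu tower_flip_funpow)
  next
    case False
    \<comment> \<open>Here \<open>x\<close> is the top of its tower and \<open>f x\<close> is the base point of the next one.\<close>
    define v where "v = first_return f M u"
    have i: "return_time f M u = Suc i" using False u by simp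
    have v: "v \<in> M" using u first_return_in by (simp add: v_def)
    have "f x = v" using u by (simp add: v_def xu first_return_def i)
    then have "f (tower_flip f M g (f x)) = f ((f ^^ (return_time f M v - 1)) (g v))"
      using tower_flip_funpow[of v M 0 g] v return_time_works(1) by simp
    also have "\<dots> = first_return f M (g v)"
      using v g return_time_works(1)
      by (simp add: first_return_def funpow_pred)
    finally show ?thesis using base[OF u(1)] u i by (simp add: v_def xu tower_flip_funpow)
  qed
qed

end

end

section \<open>Commuting permutations\<close>

text \<open>
  On an orbit of the abelian group generated by \<open>f\<close> and \<open>t\<close>, choose a base point \<open>r\<close> and send \<open>h r\<close> to
  \<open>inv h r\<close> for every group element \<open>h\<close>. Commutativity makes this independent of the choice of \<open>h\<close>
  and shows that it inverts every element of the group.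
\<close>

lemma commuting_permutations_inverted:
  assumes fin: "finite V" and f: "f permutes V" and t: "t permutes V" and comm: "f \<circ> t = t \<circ> f"
  shows "\<exists>\<gamma>. \<gamma> permutes V \<and> f \<circ> \<gamma> \<circ> f = \<gamma> \<and> t \<circ> \<gamma> \<circ> t = \<gamma>"
proof -
  \<comment> \<open>Inverses need no negative exponents, since every element has finite order on \<open>V\<close>.\<close>
  define G where "G = {f ^^ i \<circ> t ^^ j | i j. True}"
  have "f (t x) = t (f x)" for x using comm by (metis o_apply)
  then have "f ((t ^^ j) x) = (t ^^ j) (f x)" for j x by (induction j) simp_all
  then have "(f ^^ i) ((t ^^ j) x) = (t ^^ j) ((f ^^ i) x)" for i j x by (induction i) simp_all
  then have ft: "f ^^ i \<circ> t ^^ j = t ^^ j \<circ> f ^^ i" for i j by auto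
  have GI: "f ^^ i \<circ> t ^^ j \<in> G" for i j by (auto simp: G_def)
  have G_mult: "h \<circ> k \<in> G" and G_comm: "h \<circ> k = k \<circ> h" if G: "h \<in> G" "k \<in> G" for h k
  proof -
    obtain i j i' j' where hk: "h = f ^^ i \<circ> t ^^ j" "k = f ^^ i' \<circ> t ^^ j'"
      using G unfolding G_def by blast
    have "(f ^^ i \<circ> t ^^ j) \<circ> (f ^^ i' \<circ> t ^^ j') = f ^^ (i + i') \<circ> t ^^ (j + j')" for i j i' j'
    proof -
      have "(f ^^ i \<circ> t ^^ j) \<circ> (f ^^ i' \<circ> t ^^ j') = f ^^ i \<circ> (t ^^ j \<circ> f ^^ i') \<circ> t ^^ j'"
        by (simp only: o_assoc)
      also have "\<dots> = f ^^ i \<circ> (f ^^ i' \<circ> t ^^ j) \<circ> t ^^ j'" by (simp only: ft)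
      finally show ?thesis by (simp only: funpow_add o_assoc)
    qed
    then show "h \<circ> k \<in> G" "h \<circ> k = k \<circ> h" unfolding hk by (simp_all add: GI add.commute)
  qed
  have G_perm: "h permutes V" if "h \<in> G" for h
    using that by (auto simp: G_def intro: permutes_compose permutes_funpow f t)
  have G_inj: "h x = h y \<longleftrightarrow> x = y" if "h \<in> G" for h x y
    using permutes_inj[OF G_perm[OF that]] by (simp add: inj_eq)
  have G_id: "id \<in> G" using GI[of 0 0] by (simp add: id_def[symmetric])
  have fG: "f \<in> G" using GI[of 1 0] by simp
  have tG: "t \<in> G" using GI[of 0 1] by simp
  have G_pow: "h ^^ n \<in> G" if "h \<in> G" for h n
  proof (induction n)
    case (Suc n)
    then show ?case unfolding funpow.simps by (rule G_mult[OF that])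
  qed (use G_id in \<open>simp add: id_def\<close>)
  have G_sym: "\<exists>k\<in>G. x = k y" if "h \<in> G" "y = h x" for h x y
  proof -
    have "permutation h" using G_perm[OF that(1)] fin by (auto simp: permutation_permutes)
    then obtain n where n: "0 < n" "(h ^^ n) x = x" using permutation_self by metis
    then have "(h ^^ (n - 1)) y = x"
      using that by (cases n) (auto simp: funpow_swap1)
    then show ?thesis using G_pow[OF that(1)] by metis
  qed
  \<comment> \<open>The chosen base point of the orbit of \<open>x\<close>; the choice depends on the orbit only.\<close>
  define r where "r x = (SOME y. \<exists>h\<in>G. y = h x)" for x
  have r: "\<exists>h\<in>G. x = h (r x)" for x
  proof -
    have "\<exists>h\<in>G. r x = h x" unfolding r_def by (rule someI[of _ x]) (use G_id in \<open>auto intro: bexI[of _ id]\<close>)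
    then show ?thesis using G_sym by blast
  qed
  have r_inv: "r (h x) = r x" if h: "h \<in> G" for h x
  proof -
    have "(\<exists>k\<in>G. y = k (h x)) \<longleftrightarrow> (\<exists>k\<in>G. y = k x)" for y
    proof
      assume "\<exists>k\<in>G. y = k (h x)"
      then show "\<exists>k\<in>G. y = k x" using G_mult that by (metis o_apply)
    next
      assume "\<exists>k\<in>G. y = k x"
      then obtain k where "k \<in> G" "y = k x" by blast
      moreover obtain h' where "h' \<in> G" "x = h' (h x)" using G_sym[OF h refl] by blast
      ultimately show "\<exists>k\<in>G. y = k (h x)" using G_mult by (metis o_apply)
    qed
    then show ?thesis by (simp add: r_def)
  qed
  \<comment> \<open>With \<open>x = h (r x)\<close>, the value \<open>inv h (r x)\<close> is the \<open>y\<close> that satisfies \<open>r x = h y\<close>.\<close>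
  define \<gamma> where "\<gamma> x = (SOME y. \<exists>h\<in>G. x = h (r x) \<and> r x = h y)" for x
  have \<gamma>I: "\<gamma> x = y" if h: "h \<in> G" "x = h (r x)" "r x = h y" for h x y
    unfolding \<gamma>_def
  proof (rule some_equality)
    show "\<exists>h\<in>G. x = h (r x) \<and> r x = h y" using h by blast
  next
    fix z assume "\<exists>h\<in>G. x = h (r x) \<and> r x = h z"
    then obtain k where k: "k \<in> G" "x = k (r x)" "r x = k z" by blast
    have "h (k z) = x" using h k by simp
    moreover have "h (k y) = x" using h k G_comm[OF h(1) k(1)] by (metis o_apply)
    ultimately show "z = y" using G_inj[OF h(1)] G_inj[OF k(1)] by metis
  qed
  have \<gamma>_ex: "\<exists>h\<in>G. x = h (r x) \<and> r x = h (\<gamma> x)" for x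
  proof -
    obtain h where h: "h \<in> G" "x = h (r x)" using r by blast
    have "r x = h (inv h (r x))" using permutes_inverses[OF G_perm[OF h(1)]] by simp
    then have "\<gamma> x = inv h (r x)" using \<gamma>I h by blast
    then show ?thesis using h \<open>r x = h (inv h (r x))\<close> by auto
  qed
  have inverts: "k (\<gamma> (k x)) = \<gamma> x" if "k \<in> G" for k x
  proof -
    obtain h where h: "h \<in> G" "k x = h (r (k x))" "r (k x) = h (\<gamma> (k x))" using \<gamma>_ex by blast
    have rk: "r (k x) = r x" using r_inv that by simp
    obtain h0 where h0: "h0 \<in> G" "x = h0 (r x)" "r x = h0 (\<gamma> x)" using \<gamma>_ex by blast
    have "k (h0 (r x)) = h (r x)" using h h0 rk by metis
    moreover have "h0 (k (\<gamma> (k x))) = r x"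
    proof -
      have "h (h0 (k (\<gamma> (k x)))) = h0 (k (h (\<gamma> (k x))))"
        using G_comm h(1) h0(1) that by (metis o_apply)
      also have "\<dots> = h0 (k (r x))" using h rk by simp
      also have "\<dots> = h (r x)" using \<open>k (h0 (r x)) = h (r x)\<close> G_comm h0(1) that by (metis o_apply)
      finally show ?thesis using G_inj h(1) by metis
    qed
    ultimately show ?thesis using h0 G_inj[OF h0(1)] by metis
  qed
  have "\<gamma> permutes V"
  proof (rule bij_imp_permutes)
    have "\<gamma> x \<in> V" if "x \<in> V" for x
      using \<gamma>_ex[of x] that by (metis G_perm permutes_in_image)
    moreover have "inj_on \<gamma> V"
    proof (rule inj_onI)
      fix x y assume eq: "\<gamma> x = \<gamma> y"
      obtain h where h: "h \<in> G" "x = h (r x)" "r x = h (\<gamma> x)" using \<gamma>_ex by blast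
      obtain k where k: "k \<in> G" "y = k (r y)" "r y = k (\<gamma> y)" using \<gamma>_ex by blast
      have "r x = r (\<gamma> x)" "r y = r (\<gamma> y)" using h k r_inv by metis+
      then have "r x = r y" using eq by simp
      then have "x = h (k (\<gamma> x))" "y = k (h (\<gamma> x))" using h k eq by metis+
      then show "x = y" using G_comm[OF h(1) k(1)] by (metis o_apply)
    qed
    ultimately show "bij_betw \<gamma> V V"
      using fin by (simp add: bij_betw_def endo_inj_surj image_subset_iff)
  next
    fix x assume "x \<notin> V"
    moreover obtain h where h: "h \<in> G" "x = h (r x)" "r x = h (\<gamma> x)" using \<gamma>_ex by blast
    ultimately show "\<gamma> x = x" using G_perm[OF h(1)] by (metis permutes_in_image permutes_not_in)
  qed
  moreover have "f \<circ> \<gamma> \<circ> f = \<gamma>" "t \<circ> \<gamma> \<circ> t = \<gamma>" using inverts[OF fG] inverts[OF tG] by (simp_all add: fun_eq_iff)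
  ultimately show ?thesis by blast
qed

section \<open>Square roots of small permutations\<close>

text \<open>
  Two base points get the same label exactly if they lie on the same cycle of \<open>b\<close>. Since points of one
  cycle cannot be separated by a set that \<open>b\<close> maps into itself, this is expressed without reference to
  iterates of \<open>b\<close>, which suits concrete permutations of three or four points.
\<close>

definition labels_cycles :: "('a \<Rightarrow> 'a) \<Rightarrow> 'a set \<Rightarrow> ('a \<Rightarrow> 'k) \<Rightarrow> bool" where
  "labels_cycles b M p \<longleftrightarrow>
     (\<forall>e\<in>M. p (b e) = p e) \<and>
     (\<forall>S\<subseteq>M. (\<forall>e\<in>S. b e \<in> S) \<longrightarrow> (\<forall>e\<in>S. \<forall>e'\<in>M - S. p e \<noteq> p e'))"

lemma labels_cycles_step: "labels_cycles b M p \<Longrightarrow> e \<in> M \<Longrightarrow> p (b e) = p e"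
  by (simp add: labels_cycles_def)

lemma labels_cycles_separate:
  "labels_cycles b M p \<Longrightarrow> S \<subseteq> M \<Longrightarrow> \<forall>e\<in>S. b e \<in> S \<Longrightarrow> \<forall>e\<in>S. \<forall>e'\<in>M - S. p e \<noteq> p e'"
  by (simp add: labels_cycles_def)

text \<open>
  Here \<open>l\<close> assigns lengths to segments, \<open>p\<close> records which segments form a cycle of a permutation \<open>f\<close>, and
  \<open>q\<close> which segments form a cycle of \<open>d \<circ> f\<close>; equal labels stand for cycles that are matched with each
  other, and matched cycles have equal total length. An involution \<open>\<pi>\<close> with \<open>\<pi> \<circ> inv b \<circ> \<pi> = d \<circ> b\<close> is
  the same as an involution \<open>r \<circ> b\<close> with \<open>r \<circ> r = d\<close>, and the only square root of a 3-cycle on its support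
  is \<open>d \<circ> d\<close>. That it has the required properties is checked on the six permutations \<open>b\<close>.
  If \<open>b\<close> is the identity or \<open>inv d\<close>, the numbers of cycles of \<open>b\<close> and \<open>d \<circ> b\<close> differ. If \<open>b = d\<close>, then
  \<open>r \<circ> b\<close> is the identity. If \<open>b\<close> is a transposition with fixed point \<open>x\<close>, then \<open>d \<circ> b\<close> is a transposition
  with another fixed point \<open>w\<close>, and \<open>r \<circ> b\<close> exchanges \<open>x\<close> and \<open>w\<close>; the lengths force the cycle of \<open>x\<close>
  to be matched with that of \<open>w\<close>, since the segment \<open>x\<close> is shorter than the two segments, \<open>x\<close> among
  them, of the other cycle of \<open>d \<circ> b\<close>.
\<close>

lemma square_root_three_cycle:
  fixes l :: "'a \<Rightarrow> nat"
  assumes M: "M = {x, y, z}" "x \<noteq> y" "x \<noteq> z" "y \<noteq> z"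
    and d: "d x = y" "d y = z" "d z = x"
    and b: "b permutes M" and l: "\<And>e. e \<in> M \<Longrightarrow> 0 < l e"
    and p: "labels_cycles b M p" and q: "labels_cycles (d \<circ> b) M q"
    and weight: "\<And>k. (\<Sum>e\<in>M. if p e = k then l e else 0) = (\<Sum>e\<in>M. if q e = k then l e else 0)"
    and e: "e \<in> M"
  shows "d (d (b (d (d (b e))))) = e \<and> l (d (d (b e))) = l e \<and> q (d (d (b e))) = p e"
proof -
  have inM: "x \<in> M" "y \<in> M" "z \<in> M" using M by auto
  have inj: "b x \<noteq> b y" "b x \<noteq> b z" "b y \<noteq> b z"
    using inj_eq[OF permutes_inj[OF b]] M by auto
  have vals: "b x = x \<or> b x = y \<or> b x = z" "b y = x \<or> b y = y \<or> b y = z"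
    "b z = x \<or> b z = y \<or> b z = z"
    using permutes_in_image[OF b] M by auto
  have s: "(if p x = k then l x else 0) + (if p y = k then l y else 0) + (if p z = k then l z else 0)
      = (if q x = k then l x else 0) + (if q y = k then l y else 0) + (if q z = k then l z else 0)" for k
    using weight[of k] M by (auto simp: add.assoc)
  have pos: "l x > 0" "l y > 0" "l z > 0" using l M by auto
  have step: "p (b x) = p x" "p (b y) = p y" "p (b z) = p z"
    "q (d (b x)) = q x" "q (d (b y)) = q y" "q (d (b z)) = q z"
    using labels_cycles_step[OF p] labels_cycles_step[OF q] inM by auto
  note ps = labels_cycles_separate[OF p] and qs = labels_cycles_separate[OF q]
  have P: "b x = x \<Longrightarrow> p x \<noteq> p y \<and> p x \<noteq> p z"
    "b y = y \<Longrightarrow> p y \<noteq> p x \<and> p y \<noteq> p z"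
    "b z = z \<Longrightarrow> p z \<noteq> p x \<and> p z \<noteq> p y"
    using ps[of "{x}"] ps[of "{y}"] ps[of "{z}"] M by simp_all
  have Q: "d (b x) = x \<Longrightarrow> q x \<noteq> q y \<and> q x \<noteq> q z"
    "d (b y) = y \<Longrightarrow> q y \<noteq> q x \<and> q y \<noteq> q z"
    "d (b z) = z \<Longrightarrow> q z \<noteq> q x \<and> q z \<noteq> q y"
    using qs[of "{x}"] qs[of "{y}"] qs[of "{z}"] M by simp_all
  note ne = M(2-) M(2-)[symmetric]
  have "\<forall>e\<in>M. d (d (b (d (d (b e))))) = e \<and> l (d (d (b e))) = l e \<and> q (d (d (b e))) = p e"
    unfolding M(1) ball_simps
    using vals inj ne
    by (elim disjE; simp?)
      (use s[of "p x"] s[of "p y"] s[of "p z"] pos step P Q d in \<open>simp_all split: if_splits\<close>)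
  then show ?thesis using e by blast
qed

text \<open>
  A double transposition has exactly two square roots on its support, the 4-cycle through \<open>x\<close>, \<open>y\<close>, \<open>x'\<close>,
  \<open>y'\<close> and its inverse. Among the 24 permutations \<open>b\<close>, those for which \<open>b\<close> and \<open>d \<circ> b\<close> have different
  numbers of cycles are impossible. For each of the others at least one of the two roots works; which
  one may depend on how the cycles are matched, for instance when \<open>b\<close> is a double transposition
  different from \<open>d\<close>.
\<close>

lemma square_root_double_transposition:
  fixes l :: "'a \<Rightarrow> nat"
  assumes M: "M = {x, y, x', y'}" "x \<noteq> y" "x \<noteq> x'" "x \<noteq> y'" "y \<noteq> x'" "y \<noteq> y'" "x' \<noteq> y'"
    and d: "d x = x'" "d x' = x" "d y = y'" "d y' = y"
    and b: "b permutes M" and l: "\<And>e. e \<in> M \<Longrightarrow> 0 < l e"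
    and p: "labels_cycles b M p" and q: "labels_cycles (d \<circ> b) M q"
    and weight: "\<And>k. (\<Sum>e\<in>M. if p e = k then l e else 0) = (\<Sum>e\<in>M. if q e = k then l e else 0)"
    and r1: "r1 x = y" "r1 y = x'" "r1 x' = y'" "r1 y' = x"
    and r2: "r2 x = y'" "r2 y = x" "r2 x' = y" "r2 y' = x'"
  shows "(\<forall>e\<in>M. r1 (b (r1 (b e))) = e \<and> l (r1 (b e)) = l e \<and> q (r1 (b e)) = p e) \<or>
    (\<forall>e\<in>M. r2 (b (r2 (b e))) = e \<and> l (r2 (b e)) = l e \<and> q (r2 (b e)) = p e)"
proof -
  have inM: "x \<in> M" "y \<in> M" "x' \<in> M" "y' \<in> M" using M by auto
  have inj: "b x \<noteq> b y" "b x \<noteq> b x'" "b x \<noteq> b y'" "b y \<noteq> b x'" "b y \<noteq> b y'" "b x' \<noteq> b y'"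
    using inj_eq[OF permutes_inj[OF b]] M by auto
  have vals: "b x = x \<or> b x = y \<or> b x = x' \<or> b x = y'" "b y = x \<or> b y = y \<or> b y = x' \<or> b y = y'"
    "b x' = x \<or> b x' = y \<or> b x' = x' \<or> b x' = y'" "b y' = x \<or> b y' = y \<or> b y' = x' \<or> b y' = y'"
    using permutes_in_image[OF b] M by auto
  have s: "(if p x = k then l x else 0) + (if p y = k then l y else 0)
        + (if p x' = k then l x' else 0) + (if p y' = k then l y' else 0)
      = (if q x = k then l x else 0) + (if q y = k then l y else 0)
        + (if q x' = k then l x' else 0) + (if q y' = k then l y' else 0)" for k
    using weight[of k] M by (auto simp: add.assoc)
  have pos: "l x > 0" "l y > 0" "l x' > 0" "l y' > 0" using l M by auto
  have step: "p (b x) = p x" "p (b y) = p y" "p (b x') = p x'" "p (b y') = p y'"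
    "q (d (b x)) = q x" "q (d (b y)) = q y" "q (d (b x')) = q x'" "q (d (b y')) = q y'"
    using labels_cycles_step[OF p] labels_cycles_step[OF q] inM by auto
  note ps = labels_cycles_separate[OF p] and qs = labels_cycles_separate[OF q]
  \<comment> \<open>Up to complements, these are all the proper nonempty subsets of \<open>M\<close>.\<close>
  have P: "b x = x \<Longrightarrow> p x \<noteq> p y \<and> p x \<noteq> p x' \<and> p x \<noteq> p y'"
    "b y = y \<Longrightarrow> p y \<noteq> p x \<and> p y \<noteq> p x' \<and> p y \<noteq> p y'"
    "b x' = x' \<Longrightarrow> p x' \<noteq> p x \<and> p x' \<noteq> p y \<and> p x' \<noteq> p y'"
    "b y' = y' \<Longrightarrow> p y' \<noteq> p x \<and> p y' \<noteq> p x' \<and> p y' \<noteq> p y"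
    "b x \<in> {x,y} \<Longrightarrow> b y \<in> {x,y}
      \<Longrightarrow> p x \<noteq> p x' \<and> p x \<noteq> p y' \<and> p y \<noteq> p x' \<and> p y \<noteq> p y'"
    "b x \<in> {x,x'} \<Longrightarrow> b x' \<in> {x,x'}
      \<Longrightarrow> p x \<noteq> p y \<and> p x \<noteq> p y' \<and> p x' \<noteq> p y \<and> p x' \<noteq> p y'"
    "b x \<in> {x,y'} \<Longrightarrow> b y' \<in> {x,y'}
      \<Longrightarrow> p x \<noteq> p x' \<and> p x \<noteq> p y \<and> p y' \<noteq> p x' \<and> p y' \<noteq> p y"
    using ps[of "{x}"] ps[of "{y}"] ps[of "{x'}"] ps[of "{y'}"]
      ps[of "{x,y}"] ps[of "{x,x'}"] ps[of "{x,y'}"] M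
    by simp_all
  have Q: "d (b x) = x \<Longrightarrow> q x \<noteq> q y \<and> q x \<noteq> q x' \<and> q x \<noteq> q y'"
    "d (b y) = y \<Longrightarrow> q y \<noteq> q x \<and> q y \<noteq> q x' \<and> q y \<noteq> q y'"
    "d (b x') = x' \<Longrightarrow> q x' \<noteq> q x \<and> q x' \<noteq> q y \<and> q x' \<noteq> q y'"
    "d (b y') = y' \<Longrightarrow> q y' \<noteq> q x \<and> q y' \<noteq> q x' \<and> q y' \<noteq> q y"
    "d (b x) \<in> {x,y} \<Longrightarrow> d (b y) \<in> {x,y}
      \<Longrightarrow> q x \<noteq> q x' \<and> q x \<noteq> q y' \<and> q y \<noteq> q x' \<and> q y \<noteq> q y'"
    "d (b x) \<in> {x,x'} \<Longrightarrow> d (b x') \<in> {x,x'}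
      \<Longrightarrow> q x \<noteq> q y \<and> q x \<noteq> q y' \<and> q x' \<noteq> q y \<and> q x' \<noteq> q y'"
    "d (b x) \<in> {x,y'} \<Longrightarrow> d (b y') \<in> {x,y'}
      \<Longrightarrow> q x \<noteq> q x' \<and> q x \<noteq> q y \<and> q y' \<noteq> q x' \<and> q y' \<noteq> q y"
    using qs[of "{x}"] qs[of "{y}"] qs[of "{x'}"] qs[of "{y'}"]
      qs[of "{x,y}"] qs[of "{x,x'}"] qs[of "{x,y'}"] M
    by simp_all
  note ne = M(2-) M(2-)[symmetric]
  show ?thesis
    unfolding M(1) ball_simps
    using vals inj ne
    by (elim disjE; simp?)
      (use s[of "p x"] s[of "p y"] s[of "p x'"] s[of "p y'"] pos step P Q d r1 r2
        in \<open>simp_all split: if_splits\<close>)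
qed

text \<open>
  Evenness rules out transpositions and 4-cycles, neither of which is a square on its own support.
\<close>

lemma even_support_le_4_cases:
  fixes d :: "'a \<Rightarrow> 'a"
  assumes d: "permutation d" and even: "evenperm d"
    and M: "M = {x. d x \<noteq> x}" and card: "card M \<le> 4"
  obtains (identity) "M = {}"
  | (three_cycle) x y z where "M = {x, y, z}" "x \<noteq> y" "x \<noteq> z" "y \<noteq> z"
      "d x = y" "d y = z" "d z = x"
  | (double_transposition) x y x' y' where "M = {x, y, x', y'}"
      "x \<noteq> y" "x \<noteq> x'" "x \<noteq> y'" "y \<noteq> x'" "y \<noteq> y'" "x' \<noteq> y'"
      "d x = x'" "d x' = x" "d y = y'" "d y' = y"
proof -
  have fin: "finite M" using permutation_finite_support[OF d] by (simp add: M)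
  have inj: "d u = d v \<longleftrightarrow> u = v" for u v
    using permutation_bijective[OF d] by (simp add: bij_is_inj inj_eq)
  have dM: "d u \<in> M \<longleftrightarrow> u \<in> M" for u using inj by (auto simp: M)
  have moved: "d u \<noteq> u" if "u \<in> M" for u using that by (simp add: M)
  have four: "M = {u, v, w, s}" if "distinct [u, v, w, s]" "{u, v, w, s} \<subseteq> M" for u v w s
    using card_seteq[OF fin that(2)] that(1) card by simp
  show ?thesis
  proof (cases "M = {}")
    case False
    then obtain x where x: "x \<in> M" by blast
    define y where "y = d x"
    have y: "y \<in> M" "y \<noteq> x" using x dM moved by (auto simp: y_def)
    show ?thesis
    proof (cases "d y = x")
      case dy: True
      have "M \<noteq> {x, y}"
      proof
        assume "M = {x, y}"
        then have "d = transpose x y" using dy y y_def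
          by (auto simp: fun_eq_iff transpose_def M set_eq_iff)
        then show False using even y by (simp add: evenperm_swap)
      qed
      then obtain w where w: "w \<in> M" "w \<noteq> x" "w \<noteq> y" using x y by blast
      have dw: "d w \<in> M" "d w \<noteq> x" "d w \<noteq> y" "d w \<noteq> w"
        using w moved[OF w(1)] dM[of w] inj[of w y] inj[of w x] dy y_def by auto
      have eq: "M = {x, w, y, d w}" using four[of x w y "d w"] x y w dw by auto
      have "d (d w) \<in> M" "d (d w) \<noteq> d w" "d (d w) \<noteq> x" "d (d w) \<noteq> y"
        using dw moved[OF dw(1)] dM[of "d w"] inj[of "d w" y] inj[of "d w" x] dy y_def by auto
      then have ddw: "d (d w) = w" using eq by blast
      show ?thesis
        by (rule double_transposition[OF eq])
          (use y(2) w(2,3) dw(2-4) dy ddw y_def in \<open>simp_all add: eq_commute\<close>)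
    next
      case False
      define z where "z = d y"
      have z: "z \<in> M" "z \<noteq> x" "z \<noteq> y" using y dM moved False by (auto simp: z_def)
      show ?thesis
      proof (cases "d z = x")
        case dz: True
        have "M = {x, y, z}"
        proof (rule ccontr)
          assume "M \<noteq> {x, y, z}"
          then obtain w where w: "w \<in> M" "w \<noteq> x" "w \<noteq> y" "w \<noteq> z" using x y z by blast
          then have "M = {x, y, z, w}" using four[of x y z w] x y z by auto
          moreover have "d w \<in> M" "d w \<noteq> x" "d w \<noteq> y" "d w \<noteq> z" "d w \<noteq> w"
            using w moved[OF w(1)] dM[of w] inj[of w x] inj[of w y] inj[of w z] dz y_def z_def by auto
          ultimately show False by blast
        qed
        then show ?thesis by (intro three_cycle[of x y z]) (use y z dz y_def z_def in auto)
      next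
        case False
        define w where "w = d z"
        have w: "w \<in> M" "w \<noteq> x" "w \<noteq> y" "w \<noteq> z"
          using z moved[OF z(1)] dM[of z] False inj[of z x] inj[of z y] y_def z_def w_def by auto
        have eq: "M = {x, y, z, w}" using four[of x y z w] x y z w by auto
        have "d w \<in> M" "d w \<noteq> y" "d w \<noteq> z" "d w \<noteq> w"
          using w moved[OF w(1)] dM[of w] inj[of w x] inj[of w y] y_def z_def w_def by auto
        then have "d w = x" using eq by blast
        moreover have "d u = u" if "u \<notin> {x, y, z, w}" for u using that eq M by blast
        ultimately have "d u = (transpose x y \<circ> (transpose y z \<circ> transpose z w)) u" for u
          using y z w y_def[symmetric] z_def[symmetric] w_def[symmetric]
          by (cases "u \<in> {x, y, z, w}") (auto simp: transpose_def)
        then have "d = transpose x y \<circ> (transpose y z \<circ> transpose z w)" by blast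
        then have "\<not> evenperm d"
          using y z w by (simp add: evenperm_comp permutation_compose permutation_swap_id evenperm_swap)
        with even show ?thesis by simp
      qed
    qed
  qed (rule identity)
qed

lemma exists_square_root:
  fixes l :: "'a \<Rightarrow> nat"
  assumes d: "permutation d" and even: "evenperm d"
    and M: "M = {x. d x \<noteq> x}" and card: "card M \<le> 4"
    and b: "b permutes M" and l: "\<And>e. e \<in> M \<Longrightarrow> 0 < l e"
    and p: "labels_cycles b M p" and q: "labels_cycles (d \<circ> b) M q"
    and weight: "\<And>k. (\<Sum>e\<in>M. if p e = k then l e else 0) = (\<Sum>e\<in>M. if q e = k then l e else 0)"
  obtains r where "\<And>e. e \<in> M \<Longrightarrow> r e \<in> M" "\<And>e. e \<in> M \<Longrightarrow> r (r e) = d e"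
    "\<And>e. e \<in> M \<Longrightarrow> r (b (r (b e))) = e" "\<And>e. e \<in> M \<Longrightarrow> l (r (b e)) = l e"
    "\<And>e. e \<in> M \<Longrightarrow> q (r (b e)) = p e"
  using d even M card
proof (cases rule: even_support_le_4_cases)
  case identity
  then show ?thesis using that[of id] by simp
next
  case (three_cycle x y z)
  note root = square_root_three_cycle[OF three_cycle b l p q weight]
  show ?thesis
  proof (rule that[of "d \<circ> d"])
    show "(d \<circ> d) e \<in> M" "(d \<circ> d) ((d \<circ> d) e) = d e" if "e \<in> M" for e
      using that three_cycle by auto
  qed (use root in auto)
next
  case (double_transposition x y x' y')
  define r1 where "r1 = id(x := y, y := x', x' := y', y' := x)"
  define r2 where "r2 = id(x := y', y' := x', x' := y, y := x)"
  note dt = double_transposition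
  have r1: "r1 x = y" "r1 y = x'" "r1 x' = y'" "r1 y' = x"
    and r2: "r2 x = y'" "r2 y = x" "r2 x' = y" "r2 y' = x'"
    using dt(2-7) by (auto simp: r1_def r2_def)
  have in_M: "r1 e \<in> M" "r2 e \<in> M" and sq: "r1 (r1 e) = d e" "r2 (r2 e) = d e" if "e \<in> M" for e
  proof -
    from that dt(1) consider "e = x" | "e = y" | "e = x'" | "e = y'" by blast
    then show "r1 e \<in> M" "r2 e \<in> M" "r1 (r1 e) = d e" "r2 (r2 e) = d e"
      by (cases; simp add: r1 r2 dt(1) dt(8-11))+
  qed
  show ?thesis
    using square_root_double_transposition[OF dt b l p q weight r1 r2] that[of r1] that[of r2] in_M sq
    by blast
qed

section \<open>Reflections of the bottom rows\<close>

text \<open>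
  A permutation \<open>d\<close> supported on \<open>M\<close> does not interfere with the ascent in a tower over \<open>M\<close>. Therefore
  \<open>f\<close> and \<open>d \<circ> f\<close> have the same towers, and only the order in which the towers are joined changes.
\<close>

lemma funpow_modified_below_return:
  assumes "\<And>x. x \<notin> M \<Longrightarrow> d x = x" "i < return_time f M u"
  shows "((d \<circ> f) ^^ i) u = (f ^^ i) u"
  using assms(2)
proof (induction i)
  case (Suc i)
  then show ?case using assms(1) funpow_not_in_base[of "Suc i" f M u] by simp
qed simp

lemma return_modified:
  assumes f: "permutation f" and d: "\<And>x. x \<notin> M \<Longrightarrow> d x = x" "\<And>x. x \<in> M \<Longrightarrow> d x \<in> M" and u: "u \<in> M"
  shows "return_time (d \<circ> f) M u = return_time f M u"
    and "first_return (d \<circ> f) M u = d (first_return f M u)"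
proof -
  let ?k = "return_time f M u"
  have k: "0 < ?k" "(f ^^ ?k) u \<in> M" using return_time_works[OF f u] .
  have "((d \<circ> f) ^^ ?k) u = (d \<circ> f) (((d \<circ> f) ^^ (?k - Suc 0)) u)"
    using k by (simp only: funpow_pred)
  also have "\<dots> = d (f ((f ^^ (?k - Suc 0)) u))"
    using funpow_modified_below_return[where i = "?k - Suc 0", OF d(1)] k by simp
  also have "\<dots> = d ((f ^^ ?k) u)" using k by (simp only: funpow_pred)
  finally have top: "((d \<circ> f) ^^ ?k) u = d ((f ^^ ?k) u)" .
  show time: "return_time (d \<circ> f) M u = ?k"
  proof (rule return_time_eqI)
    show "((d \<circ> f) ^^ ?k) u \<in> M" using top k d by simp
    show "((d \<circ> f) ^^ j) u \<notin> M" if "0 < j" "j < ?k" for j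
      using that funpow_modified_below_return[where i = j, OF d(1)] funpow_not_in_base[of j f M u] by simp
  qed (rule k)
  show "first_return (d \<circ> f) M u = d (first_return f M u)"
    using u top by (simp add: first_return_def time)
qed

lemma saturation_modified:
  assumes f: "permutation f" and d: "permutation (d \<circ> f)" "\<And>x. x \<notin> M \<Longrightarrow> d x = x"
  shows "saturation f M \<subseteq> saturation (d \<circ> f) M"
proof
  fix x assume "x \<in> saturation f M"
  then obtain u i where "u \<in> M" "i < return_time f M u" "x = (f ^^ i) u"
    by (rule saturation_cases[OF f])
  then show "x \<in> saturation (d \<circ> f) M"
    using funpow_modified_below_return[OF d(2)] funpow_in_saturation[OF d(1)] by metis
qed

lemma orbit_eq_iff:
  assumes "permutation f" shows "orbit f x = orbit f y \<longleftrightarrow> x \<in> orbit f y"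
  using orbit_cyclic_eq3[OF cyclic_on_orbit'[OF assms]] permutation_self_in_orbit[OF assms] by metis

lemma orbit_funpow: "permutation f \<Longrightarrow> orbit f ((f ^^ i) x) = orbit f x"
  by (induction i) (simp_all add: permutation_orbit_step)

lemma labels_cycles_orbit:
  assumes f: "permutation f"
  shows "labels_cycles (first_return f M) M (orbit f)"
  unfolding labels_cycles_def
proof (intro conjI ballI allI impI notI)
  fix e assume "e \<in> M"
  then show "orbit f (first_return f M e) = orbit f e" by (simp add: first_return_def orbit_funpow[OF f])
next
  fix S e e' assume S: "S \<subseteq> M" "\<forall>e\<in>S. first_return f M e \<in> S" and e: "e \<in> S" "e' \<in> M - S"
    and "orbit f e = orbit f e'"
  then have "e' \<in> orbit f e" using orbit_eq_iff[OF f] by metis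
  with S e have "e' \<in> S" using base_separation[OF f, of S M e e'] by blast
  with e show False by simp
qed

lemma sum_return_time_orbit:
  assumes f: "permutation f" and M: "finite M" and x: "x \<in> saturation f M"
  shows "(\<Sum>e\<in>M. if orbit f e = orbit f x then return_time f M e else 0) = card (orbit f x)"
proof -
  have "card (orbit f x) = (\<Sum>u\<in>M \<inter> orbit f x. return_time f M u)"
  proof (rule card_eq_sum_return_time[OF f _ _ M])
    obtain u where "u \<in> M" "x \<in> orbit f u" using x by (auto simp: saturation_def)
    then show "orbit f x \<subseteq> saturation f M"
      using orbit_eq_iff[OF f] by (auto simp: saturation_def)
    show "f y \<in> orbit f x \<longleftrightarrow> y \<in> orbit f x" for y
      by (simp only: orbit_eq_iff[OF f, symmetric] permutation_orbit_step[OF f])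
  qed
  also have "\<dots> = (\<Sum>e\<in>M. if orbit f e = orbit f x then return_time f M e else 0)"
    using M by (simp add: orbit_eq_iff[OF f] sum.inter_restrict)
  finally show ?thesis by simp
qed

text \<open>
  The case in which every cycle of \<open>f\<close> meets the support \<open>M\<close> of \<open>d\<close>. The relation says that \<open>T\<close> carries the
  cycles of \<open>f\<close> to the cycles of \<open>d \<circ> f\<close>. The cycles of both are cut by \<open>M\<close> into the same at most four
  segments. The involution \<open>\<pi> = r \<circ> b\<close> of the segments yields, by reversing each segment, an involution
  \<open>\<rho>\<close> that carries each cycle of \<open>f\<close>, with reversed direction, to a cycle of \<open>d \<circ> f\<close>, namely to the
  one to which \<open>T\<close> carries it. Then \<open>g = inv T \<circ> \<rho>\<close> preserves every cycle of \<open>f\<close> and reverses it, so it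
  is an involution, and \<open>T\<close> is the product of the involutions \<open>\<rho>\<close> and \<open>g\<close>, each of which therefore
  inverts \<open>T\<close>. Besides the lengths, all that matters about \<open>T\<close> is which cycles it matches.
\<close>

lemma orbit_preserving_reflection:
  fixes f T d :: "'a \<Rightarrow> 'a"
  assumes U: "finite U" and f: "f permutes U" and T: "T permutes U"
    and rel: "T \<circ> f = d \<circ> f \<circ> T"
    and M: "M = {x. d x \<noteq> x}" and card: "card M \<le> 4" and sat: "saturation f M = U"
  obtains g where "\<And>u. u \<in> U \<Longrightarrow> g u \<in> orbit f u" "\<And>u. u \<in> U \<Longrightarrow> g (g u) = u"
    "\<And>u. u \<in> U \<Longrightarrow> f (g (f u)) = g u" "\<And>u. u \<in> U \<Longrightarrow> T (g (T u)) = g u"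
proof -
  have pf: "permutation f" and pT: "permutation T"
    using f T U by (auto simp: permutation_permutes)
  have d_eq: "d = T \<circ> f \<circ> (inv T \<circ> inv f)"
  proof
    fix x
    have "d (f (T (inv T (inv f x)))) = T (f (inv T (inv f x)))"
      using rel by (metis o_apply)
    then show "d x = (T \<circ> f \<circ> (inv T \<circ> inv f)) x"
      by (simp add: permutes_inverses[OF f] permutes_inverses[OF T])
  qed
  have pd: "permutation d" unfolding d_eq
    by (intro permutation_compose permutation_inverse pf pT)
  have even: "evenperm d" unfolding d_eq
    by (simp add: evenperm_comp evenperm_inv permutation_compose permutation_inverse pf pT)
  have finM: "finite M" using permutation_finite_support[OF pd] by (simp add: M)
  have d_out: "d x = x" if "x \<notin> M" for x using that by (simp add: M)
  have d_in: "d x \<in> M" if "x \<in> M" for x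
    using that permutation_bijective[OF pd] by (simp add: M bij_is_inj inj_eq)
  have pdf: "permutation (d \<circ> f)" by (intro permutation_compose pd pf)
  have MU: "M \<subseteq> U" using base_subset_saturation[OF pf] sat by blast
  define b where "b = first_return f M"
  have b: "b permutes M" unfolding b_def by (rule first_return_permutes[OF pf finM])
  \<comment> \<open>A cycle of \<open>d \<circ> f\<close> is labelled by the cycle of \<open>f\<close> that \<open>T\<close> carries to it.\<close>
  define q where "q e = inv T ` orbit (d \<circ> f) e" for e
  have T_orbit: "T ` orbit f x = orbit (d \<circ> f) (T x)" for x
    using rel by (intro orbit_inverse permutation_self_in_orbit[OF pf]) (simp add: fun_eq_iff)
  have q_eq: "q e = orbit f (inv T e)" for e
  proof -
    have "orbit (d \<circ> f) e = T ` orbit f (inv T e)"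
      by (simp add: T_orbit permutes_inverses[OF T])
    then show ?thesis by (simp add: q_def image_image permutes_inverses[OF T])
  qed
  have labels_q: "labels_cycles (d \<circ> b) M q"
  proof -
    have "orbit (d \<circ> f) e = orbit (d \<circ> f) e' \<longleftrightarrow> q e = q e'" for e e'
      unfolding q_def using permutes_inj[OF permutes_inv[OF T]] by (simp add: inj_image_eq_iff)
    then show ?thesis
      using labels_cycles_orbit[OF pdf, of M] return_modified(2)[OF pf d_out d_in, of _]
      unfolding labels_cycles_def b_def by (simp add: subset_iff)
  qed
  have weight: "(\<Sum>e\<in>M. if orbit f e = k then return_time f M e else 0)
      = (\<Sum>e\<in>M. if q e = k then return_time f M e else 0)" for k
  proof (cases "\<exists>x\<in>U. k = orbit f x")
    case True
    then obtain x where x: "x \<in> U" "k = orbit f x" by blast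
    have "T x \<in> saturation (d \<circ> f) M"
      using x saturation_modified[OF pf pdf d_out] sat permutes_in_image[OF T] by blast
    note sum_return_time_orbit[OF pdf finM this]
    moreover have "(\<Sum>e\<in>M. if orbit (d \<circ> f) e = j then return_time (d \<circ> f) M e else 0)
        = (\<Sum>e\<in>M. if orbit (d \<circ> f) e = j then return_time f M e else 0)" for j
      by (rule sum.cong) (simp_all add: return_modified(1)[OF pf d_out d_in])
    moreover have "q e = k \<longleftrightarrow> orbit (d \<circ> f) e = orbit (d \<circ> f) (T x)" for e
      unfolding q_def x T_orbit[symmetric]
      using inj_image_eq_iff[OF permutes_inj[OF permutes_inv[OF T]], of _ "T ` orbit f x"]
      by (simp add: image_image permutes_inverses[OF T])
    moreover have "card (orbit (d \<circ> f) (T x)) = card (orbit f x)"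
      using permutes_inj_on[OF T] by (simp add: T_orbit[symmetric] card_image)
    ultimately show ?thesis
      using sum_return_time_orbit[OF pf finM, of x] x sat
      by simp
  next
    case False
    then have "orbit f e \<noteq> k" "q e \<noteq> k" if "e \<in> M" for e
      using that MU permutes_in_image[OF permutes_inv[OF T]] by (auto simp: q_eq)
    then show ?thesis by simp
  qed
  obtain r where r: "\<And>e. e \<in> M \<Longrightarrow> r e \<in> M" "\<And>e. e \<in> M \<Longrightarrow> r (r e) = d e"
    "\<And>e. e \<in> M \<Longrightarrow> r (b (r (b e))) = e" "\<And>e. e \<in> M \<Longrightarrow> return_time f M (r (b e)) = return_time f M e"
    "\<And>e. e \<in> M \<Longrightarrow> q (r (b e)) = orbit f e"
    using exists_square_root[OF pd even M card b return_time_works(1)[OF pf]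
        labels_cycles_orbit[OF pf, of M, folded b_def] labels_q weight]
    by blast
  have bM: "b e \<in> M \<longleftrightarrow> e \<in> M" for e by (rule permutes_in_image[OF b])
  \<comment> \<open>\<open>\<rho>\<close> reverses the segments, that is, the towers of \<open>f\<close> over \<open>M\<close>.\<close>
  define \<rho> where "\<rho> = tower_flip f M (r \<circ> b)"
  have flip: "(r \<circ> b) e \<in> M" "(r \<circ> b) ((r \<circ> b) e) = e"
    "return_time f M ((r \<circ> b) e) = return_time f M e" if "e \<in> M" for e
    using that r bM by auto
  have \<rho>_inv: "\<rho> (\<rho> x) = x" for x
    unfolding \<rho>_def by (rule tower_flip_involution[OF pf flip])
  have \<rho>_step: "d (f (\<rho> (f x))) = \<rho> x" if "x \<in> U" for x
    unfolding \<rho>_def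
  proof (rule tower_flip_step[OF pf flip d_out])
    show "d (first_return f M ((r \<circ> b) (first_return f M u))) = (r \<circ> b) u" if "u \<in> M" for u
      using r(2)[of "b (r (b (b u)))"] r(3)[of "b u"] r(1)[of "b (b u)"] bM that
      by (simp add: b_def[symmetric])
  qed (use that sat in auto)
  define g where "g = inv T \<circ> \<rho>"
  have g_orbit: "g x \<in> orbit f x" if "x \<in> U" for x
  proof -
    have "x \<in> saturation f M" using that sat by simp
    then obtain e i where e: "e \<in> M" "i < return_time f M e" "x = (f ^^ i) e"
      by (rule saturation_cases[OF pf])
    let ?e = "(r \<circ> b) e" and ?j = "return_time f M e - Suc i"
    have "\<rho> x = (f ^^ ?j) ?e" using e by (simp add: \<rho>_def tower_flip_funpow[OF pf])
    also have "\<dots> = ((d \<circ> f) ^^ ?j) ?e"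
      using funpow_modified_below_return[of M d ?j f ?e] d_out flip(3)[OF e(1)] e by simp
    finally have "\<rho> x \<in> orbit (d \<circ> f) ?e"
      using funpow_in_orbit[OF permutation_self_in_orbit[OF pdf]] by metis
    then have "g x \<in> q ?e" by (simp add: g_def q_def)
    also have "q ?e = orbit f x" using r(5) e by (simp add: orbit_funpow[OF pf])
    finally show ?thesis .
  qed
  have gU: "g x \<in> U" if "x \<in> U" for x
    using g_orbit[OF that] permutes_orbit_subset[OF f that] by blast
  have f_inv_T: "f (inv T y) = inv T (d (f y))" for y
    using rel permutes_inverses[OF T] by (metis o_apply)
  have gf: "f (g (f x)) = g x" if "x \<in> U" for x
    using \<rho>_step[OF that] by (simp add: g_def f_inv_T)
  have gf_funpow: "(f ^^ m) (g ((f ^^ m) x)) = g x" if "x \<in> U" for m x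
    using that
  proof (induction m arbitrary: x)
    case (Suc m)
    have "(f ^^ Suc m) (g ((f ^^ Suc m) x)) = f ((f ^^ m) (g ((f ^^ m) (f x))))"
      by (simp add: funpow_swap1)
    then show ?case using Suc gf permutes_in_image[OF f] by simp
  qed simp
  \<comment> \<open>A map that preserves a cycle and reverses its direction is an involution of it.\<close>
  have gg: "g (g x) = x" if x: "x \<in> U" for x
  proof -
    obtain m where m: "g x = (f ^^ m) x"
      using g_orbit[OF x] by (auto simp: orbit_altdef_permutation[OF pf])
    have "(f ^^ m) (g (g x)) = (f ^^ m) x" using gf_funpow[OF x, of m] m by simp
    then show ?thesis
      using bij_fn[OF permutation_bijective[OF pf]] by (metis bij_is_inj injD)
  qed
  have "T (g (T x)) = g x" if "x \<in> U" for x
  proof -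
    have "\<rho> (g x) = T x"
      using gg[OF that] permutes_inverses[OF T] by (metis g_def o_apply)
    then have "\<rho> (T x) = g x" using \<rho>_inv by metis
    then show ?thesis by (simp add: g_def permutes_inverses[OF T])
  qed
  then show ?thesis using that g_orbit gg gf by blast
qed

section \<open>Turning the cylinders\<close>

lemma perm_restrict_permutes:
  assumes "finite S" "inj f" "\<And>x. f x \<in> S \<longleftrightarrow> x \<in> S"
  shows "perm_restrict f S permutes S"
proof (rule bij_imp_permutes)
  have "f ` S = S"
    using assms inj_on_subset[OF assms(2)] by (intro endo_inj_surj) auto
  moreover have "perm_restrict f S ` S = f ` S"
    by (rule image_cong) (simp_all add: perm_restrict_def)
  moreover have "inj_on (perm_restrict f S) S"
    using assms(2) by (auto simp: inj_on_def perm_restrict_def)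
  ultimately show "bij_betw (perm_restrict f S) S S" by (simp add: bij_betw_def)
qed (simp add: perm_restrict_def)

text \<open>
  The set \<open>U\<close> of all cycles of \<open>f\<close> that meet the support \<open>M\<close> of the commutator consists of the bottom rows
  of the cylinders. A row outside \<open>U\<close> lies squarely on the row below it, that is, \<open>f\<close> and \<open>t\<close> commute
  on the way to it. So a cylinder is a stack of rows, all points of a row in \<open>U\<close> have the same
  \<open>t\<close>-tower height, and the first return \<open>T\<close> of \<open>t\<close> to \<open>U\<close> satisfies the same relation as \<open>t\<close>. The
  reflection \<open>g\<close> of the bottom rows respects the heights because it preserves the rows; flipping the
  cylinders, it extends to all points whose \<open>t\<close>-orbit meets \<open>U\<close>. On the rest, \<open>f\<close> and \<open>t\<close> commute.
\<close>

theorem small_commutator_imp_simultaneously_inverted: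
  fixes f t :: "'a \<Rightarrow> 'a"
  assumes X: "finite X" and f: "f permutes X" and t: "t permutes X"
    and card: "card {x. (t \<circ> f \<circ> inv t \<circ> inv f) x \<noteq> x} \<le> 4"
  shows "\<exists>\<gamma>. \<gamma> permutes X \<and> f \<circ> \<gamma> \<circ> f = \<gamma> \<and> t \<circ> \<gamma> \<circ> t = \<gamma>"
proof -
  define d where "d = t \<circ> f \<circ> inv t \<circ> inv f"
  define M where "M = {x. d x \<noteq> x}"
  have pf: "permutation f" and pt: "permutation t"
    using f t X by (auto simp: permutation_permutes)
  have d: "d permutes X"
    unfolding d_def by (intro permutes_compose permutes_inv f t)
  have rel: "t (f x) = d (f (t x))" for x
    by (simp add: d_def permutes_inverses[OF f] permutes_inverses[OF t])
  have d_out: "d x = x" if "x \<notin> M" for x using that by (simp add: M_def)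
  have d_in: "d x \<in> M" if "x \<in> M" for x
    using that permutes_inj[OF d] by (simp add: M_def inj_eq)

  define U where "U = saturation f M"
  have fU: "f x \<in> U \<longleftrightarrow> x \<in> U" for x unfolding U_def by (rule saturation_step_iff[OF pf])
  have MU: "M \<subseteq> U" unfolding U_def by (rule base_subset_saturation[OF pf])
  have "M \<subseteq> X" using permutes_not_in[OF d] by (auto simp: M_def)
  then have "U \<subseteq> X" using permutes_orbit_subset[OF f] by (auto simp: U_def saturation_def)
  then have finU: "finite U" using X finite_subset by blast
  have dU: "d x \<in> U" if "x \<in> U" for x using that d_out d_in MU by (cases "x \<in> M") auto
  have f_pow: "(t ^^ i) (f u) = f ((t ^^ i) u)" if "i < return_time t U u" for i u
    using that
  proof (induction i)
    case (Suc i)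
    then have "(t ^^ Suc i) u \<notin> U" by (intro funpow_not_in_base) auto
    then have "f ((t ^^ Suc i) u) \<notin> M" using fU MU by blast
    then show ?case using Suc d_out by (simp add: rel)
  qed simp
  have top: "(t ^^ return_time t U u) (f u) = d (f ((t ^^ return_time t U u) u))" if "u \<in> U" for u
  proof -
    let ?k = "return_time t U u"
    have k: "0 < ?k" using return_time_works(1)[OF pt that] .
    then have "(t ^^ ?k) (f u) = t (f ((t ^^ (?k - Suc 0)) u))"
      using f_pow[of "?k - Suc 0" u] funpow_pred[OF k, of t "f u"] by simp
    then show ?thesis using funpow_pred[OF k, of t u] by (simp add: rel)
  qed
  have time_f: "return_time t U (f u) = return_time t U u" if u: "u \<in> U" for u
  proof (rule return_time_eqI)
    show "(t ^^ return_time t U u) (f u) \<in> U"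
      using top[OF u] return_time_works(2)[OF pt u] dU fU by simp
    show "(t ^^ j) (f u) \<notin> U" if "0 < j" "j < return_time t U u" for j
      using that f_pow fU funpow_not_in_base by metis
  qed (rule return_time_works(1)[OF pt u])

  \<comment> \<open>Contracting each cylinder to its bottom row leaves permutations of \<open>U\<close>.\<close>
  define T where "T = first_return t U"
  define F where "F = perm_restrict f U"
  have T: "T permutes U" unfolding T_def by (rule first_return_permutes[OF pt finU])
  have F: "F permutes U"
    unfolding F_def by (rule perm_restrict_permutes[OF finU permutes_inj[OF f] fU])
  have F_eq: "F u = f u" if "u \<in> U" for u using that by (simp add: F_def perm_restrict_def)
  have orbit_F: "orbit F u = orbit f u" if "u \<in> U" for u
    using that fU by (intro orbit_cong0[of u U]) (auto simp: F_eq)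
  have satF: "saturation F M = U"
    using MU orbit_F unfolding U_def saturation_def by (intro SUP_cong) auto
  have T_F: "T \<circ> F = d \<circ> F \<circ> T"
  proof
    fix u
    show "(T \<circ> F) u = (d \<circ> F \<circ> T) u"
    proof (cases "u \<in> U")
      case True
      moreover have "T u \<in> U" using True permutes_in_image[OF T] by simp
      ultimately show ?thesis
        using top[OF True] fU by (simp add: T_def first_return_def F_eq time_f)
    next
      case False
      then show ?thesis
        using MU d_out permutes_not_in[OF T] permutes_not_in[OF F]
        by (metis o_apply subsetD)
    qed
  qed
  obtain g where g: "\<And>u. u \<in> U \<Longrightarrow> g u \<in> orbit F u" "\<And>u. u \<in> U \<Longrightarrow> g (g u) = u"
    "\<And>u. u \<in> U \<Longrightarrow> F (g (F u)) = g u" "\<And>u. u \<in> U \<Longrightarrow> T (g (T u)) = g u"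
    using orbit_preserving_reflection[OF finU F T T_F M_def _ satF] card
    unfolding d_def M_def by blast
  have gU: "g u \<in> U" if "u \<in> U" for u
    using g(1)[OF that] permutes_orbit_subset[OF F that] by blast
  have time_orbit: "return_time t U v = return_time t U u" if "v \<in> orbit f u" "u \<in> U" for u v
    using that
  proof induction
    case (step y)
    then have "y \<in> U" using permutes_orbit_subset[OF F] orbit_F by blast
    with step show ?case by (simp add: time_f)
  qed (simp add: time_f)
  have time_g: "return_time t U (g u) = return_time t U u" if "u \<in> U" for u
    using time_orbit g(1) orbit_F that by metis

  \<comment> \<open>\<open>W\<close> is the union of the cylinders over \<open>U\<close>.\<close>
  define W where "W = saturation t U"
  define \<gamma>\<^sub>W where "\<gamma>\<^sub>W = tower_flip t U g"
  have tW: "t x \<in> W \<longleftrightarrow> x \<in> W" for x unfolding W_def by (rule saturation_step_iff[OF pt])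
  have UW: "U \<subseteq> W" unfolding W_def by (rule base_subset_saturation[OF pt])
  have WX: "W \<subseteq> X" using \<open>U \<subseteq> X\<close> permutes_orbit_subset[OF t] by (auto simp: W_def saturation_def)
  have W_cases: "\<exists>u i. u \<in> U \<and> i < return_time t U u \<and> x = (t ^^ i) u" if "x \<in> W" for x
    using saturation_cases[OF pt that[unfolded W_def]] by metis
  have fW: "f x \<in> W \<longleftrightarrow> x \<in> W" for x
  proof -
    have "f x \<in> W" if "x \<in> W" for x
    proof -
      obtain u i where u: "u \<in> U" "i < return_time t U u" "x = (t ^^ i) u"
        using W_cases[OF \<open>x \<in> W\<close>] by blast
      then have "f x = (t ^^ i) (f u)" by (simp add: f_pow)
      then show ?thesis using u fU funpow_in_saturation[OF pt] by (simp add: W_def)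
    qed
    then have "f ` W = W"
      using finite_subset[OF WX X] permutes_inj_on[OF f] by (intro endo_inj_surj) auto
    then show ?thesis using permutes_inj[OF f] by (metis inj_image_mem_iff)
  qed
  have \<gamma>W_out: "\<gamma>\<^sub>W x = x" if "x \<notin> W" for x using that by (simp add: \<gamma>\<^sub>W_def tower_flip_def W_def)
  have \<gamma>W_in: "\<gamma>\<^sub>W x \<in> W" if "x \<in> W" for x
    using tower_flip_in_saturation[OF pt gU g(2) time_g] that by (simp add: \<gamma>\<^sub>W_def W_def)
  have \<gamma>W_invol: "\<gamma>\<^sub>W (\<gamma>\<^sub>W x) = x" for x
    unfolding \<gamma>\<^sub>W_def by (rule tower_flip_involution[OF pt gU g(2) time_g])
  have t_\<gamma>W: "t (\<gamma>\<^sub>W (t x)) = \<gamma>\<^sub>W x" if "x \<in> W" for x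
    using tower_flip_step[OF pt gU g(2) time_g, of "\<lambda>x. x" x] g(4) that
    by (simp add: \<gamma>\<^sub>W_def W_def T_def)
  have f_\<gamma>W: "f (\<gamma>\<^sub>W (f x)) = \<gamma>\<^sub>W x" if x: "x \<in> W" for x
  proof -
    obtain u i where u: "u \<in> U" "i < return_time t U u" "x = (t ^^ i) u"
      using W_cases[OF x] by blast
    let ?j = "return_time t U u - Suc i"
    have "\<gamma>\<^sub>W (f x) = (t ^^ ?j) (g (f u))"
      using tower_flip_funpow[OF pt, of "f u" U i g] u fU by (simp add: \<gamma>\<^sub>W_def f_pow[symmetric] time_f)
    also have "f \<dots> = (t ^^ ?j) (f (g (f u)))"
      using f_pow[of ?j "g (f u)"] u fU time_g time_f by simp
    also have "f (g (f u)) = g u" using g(3)[OF u(1)] u fU gU by (simp add: F_eq)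
    finally show ?thesis using u by (simp add: \<gamma>\<^sub>W_def tower_flip_funpow[OF pt])
  qed

  \<comment> \<open>\<open>V\<close> avoids \<open>U\<close> and hence \<open>M\<close>, so the two restrictions to it commute.\<close>
  define V where "V = X - W"
  define fV where "fV = perm_restrict f V"
  define tV where "tV = perm_restrict t V"
  have VX: "x \<in> V \<longleftrightarrow> x \<in> X \<and> x \<notin> W" for x by (simp add: V_def)
  have fVV: "f x \<in> V \<longleftrightarrow> x \<in> V" and tVV: "t x \<in> V \<longleftrightarrow> x \<in> V" for x
    using fW tW permutes_in_image[OF f] permutes_in_image[OF t] by (auto simp: VX)
  have "finite V" using X by (simp add: V_def)
  note restrict = perm_restrict_permutes[OF this permutes_inj]
  have "fV \<circ> tV = tV \<circ> fV"
  proof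
    fix x
    show "(fV \<circ> tV) x = (tV \<circ> fV) x"
    proof (cases "x \<in> V")
      case True
      then have "f (t x) \<in> V" using fVV tVV by simp
      then have "f (t x) \<notin> M" using UW MU VX by auto
      then show ?thesis using True fVV tVV rel d_out by (simp add: fV_def tV_def perm_restrict_def)
    qed (simp add: fV_def tV_def perm_restrict_def)
  qed
  then obtain \<gamma>\<^sub>V where \<gamma>V: "\<gamma>\<^sub>V permutes V" "fV \<circ> \<gamma>\<^sub>V \<circ> fV = \<gamma>\<^sub>V" "tV \<circ> \<gamma>\<^sub>V \<circ> tV = \<gamma>\<^sub>V"
    using commuting_permutations_inverted[OF \<open>finite V\<close> restrict[OF f fVV] restrict[OF t tVV]]
    unfolding fV_def tV_def by blast
  have \<gamma>V_V: "\<gamma>\<^sub>V x \<in> V \<longleftrightarrow> x \<in> V" for x by (rule permutes_in_image[OF \<gamma>V(1)])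
  have V_inv: "h (\<gamma>\<^sub>V (h x)) = \<gamma>\<^sub>V x"
    if "perm_restrict h V \<circ> \<gamma>\<^sub>V \<circ> perm_restrict h V = \<gamma>\<^sub>V" "h permutes X" "\<And>x. h x \<in> V \<longleftrightarrow> x \<in> V" "x \<notin> W" for h x
  proof (cases "x \<in> V")
    case True
    then show ?thesis using fun_cong[OF that(1), of x] that(3) \<gamma>V_V by (simp add: perm_restrict_def)
  next
    case False
    then have "x \<notin> X" using that(4) VX by blast
    then show ?thesis using False permutes_not_in[OF that(2)] permutes_not_in[OF \<gamma>V(1)] by simp
  qed

  define \<gamma> where "\<gamma> = \<gamma>\<^sub>V \<circ> \<gamma>\<^sub>W"
  have \<gamma>_W: "\<gamma> x = \<gamma>\<^sub>W x" if "x \<in> W" for x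
    using \<gamma>W_in[OF that] permutes_not_in[OF \<gamma>V(1)] VX by (simp add: \<gamma>_def)
  have \<gamma>_V: "\<gamma> x = \<gamma>\<^sub>V x" if "x \<notin> W" for x using that by (simp add: \<gamma>_def \<gamma>W_out)
  have "\<gamma> permutes X" unfolding \<gamma>_def
  proof (rule permutes_compose)
    have "bij \<gamma>\<^sub>W" using \<gamma>W_invol by (intro involuntory_imp_bij) simp
    then show "\<gamma>\<^sub>W permutes X"
      unfolding permutes_def bij_iff using \<gamma>W_out WX by blast
    show "\<gamma>\<^sub>V permutes X" using \<gamma>V(1) by (rule permutes_subset) (simp add: V_def)
  qed
  moreover have "f (\<gamma> (f x)) = \<gamma> x" for x
    using \<gamma>_W \<gamma>_V f_\<gamma>W V_inv[OF \<gamma>V(2)[unfolded fV_def] f fVV] fW by (cases "x \<in> W") simp_all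
  moreover have "t (\<gamma> (t x)) = \<gamma> x" for x
    using \<gamma>_W \<gamma>_V t_\<gamma>W V_inv[OF \<gamma>V(3)[unfolded tV_def] t tVV] tW by (cases "x \<in> W") simp_all
  ultimately show ?thesis by (intro exI[of _ \<gamma>]) auto
qed

theorem theorem4p9:
  fixes n :: nat and \<alpha> \<beta> :: "nat \<Rightarrow> nat"
  assumes "n > 0"
    and "\<alpha> permutes {1..n}"
    and "\<beta> permutes {1..n}"
    and "int (card {i \<in> {1..n}. perm_commutator \<alpha> \<beta> i = i}) \<ge> int n - 4"
  shows "\<exists>\<gamma>. \<gamma> permutes {1..n} \<and> perm_conj \<alpha> \<gamma> = inv \<alpha> \<and> perm_conj \<beta> \<gamma> = inv \<beta>"
proof -
  let ?X = "{1..n}" and ?K = "perm_commutator \<alpha> \<beta>"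
  note \<alpha> = assms(2) and \<beta> = assms(3)
  \<comment> \<open>With these choices the commutator of the general statement is the inverse of \<open>?K\<close>.\<close>
  let ?f = "inv \<alpha>" and ?t = "inv \<beta>"
  have K: "?K permutes ?X"
    unfolding perm_commutator_def by (intro permutes_compose permutes_inv \<alpha> \<beta>)
  have "(?t \<circ> ?f \<circ> inv ?t \<circ> inv ?f) x = x \<longleftrightarrow> ?K x = x" for x
    unfolding perm_commutator_def permutes_inv_inv[OF \<alpha>] permutes_inv_inv[OF \<beta>] o_apply
    by (metis permutes_inverses[OF \<alpha>] permutes_inverses[OF \<beta>])
  moreover have "i \<in> ?X" if "?K i \<noteq> i" for i using that permutes_not_in[OF K] by metis
  ultimately have "{x. (?t \<circ> ?f \<circ> inv ?t \<circ> inv ?f) x \<noteq> x} = ?X - {i \<in> ?X. ?K i = i}"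
    by blast
  moreover have "card (?X - {i \<in> ?X. ?K i = i}) = n - card {i \<in> ?X. ?K i = i}"
    by (subst card_Diff_subset) auto
  ultimately have "card {x. (?t \<circ> ?f \<circ> inv ?t \<circ> inv ?f) x \<noteq> x} \<le> 4"
    using assms(4) by simp
  then obtain \<gamma> where \<gamma>: "\<gamma> permutes ?X" "?f \<circ> \<gamma> \<circ> ?f = \<gamma>" "?t \<circ> \<gamma> \<circ> ?t = \<gamma>"
    using small_commutator_imp_simultaneously_inverted[OF _ permutes_inv[OF \<alpha>] permutes_inv[OF \<beta>]] by auto
  have "perm_conj h \<gamma> = inv h" if h: "h permutes ?X" and inv: "inv h \<circ> \<gamma> \<circ> inv h = \<gamma>" for h
  proof
    fix x
    have "h (\<gamma> x) = \<gamma> (inv h x)"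
      using fun_cong[OF inv, of x] permutes_inverses(1)[OF h, of "\<gamma> (inv h x)"] by simp
    then show "perm_conj h \<gamma> x = inv h x"
      by (simp add: perm_conj_def permutes_inverses[OF \<gamma>(1)])
  qed
  with \<alpha> \<beta> \<gamma> show ?thesis by blast
qed

end
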